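(* Let $\alpha$ denote a positive real exponent. (1) Let $\mathbb L$ be any finite lattice. Then for any completely monotone function $f$ on $\mathbb L$, the function $f^\alpha$ is completely monotone if $\alpha$ is an integer or $\alpha\ge d_{\max}-1$. (2) Let $\mathbb L$ be any finite distributive lattice. Then there exists a completely monotone function $f$ on $\mathbb L$ such that $f^\alpha$ is not completely monotone for any non-integer $\alpha<d_{\max}-1$. In other words, the set of $\alpha>0$ such that $f^\alpha$ is completely monotone for every completely monotone function $f$ on $\mathbb L$ is the set of those $\alpha>0$ which lie in $\mathbb N\cup[d_{\max}-1,\infty)$.
   Context: For a finite (nonempty) lattice $(\mathbb L,\le)$ with join $\vee$ and for $x\in\mathbb L$, let $d_x:=\left|\{y\in\mathbb L: y>x,\ \nexists z\in\mathbb L\text{ with }x<z<y\}\right|$ be the number of elements covering $x$, and $d_{\max}:=\max\{d_x:x\in\mathbb L\}$. A function $f:\mathbb L\to[0,\infty)$ is completely monotone if for all $n\ge1$ and all $x,x_1,\ldots,x_n\in\mathbb L$, $$\Delta_{x_n}\cdots\Delta_{x_1}f(x):=\sum_{J\subseteq[n]}(-1)^{|J|}f\Big(x\vee\bigvee_{i\in J}x_i\Big)\ge0,$$ where $[n]=\{1,\ldots,n\}$ and for $J=\emptyset$ the argument of $f$ is $x$. Equivalently, $\Delta_y f(x)=f(x)-f(x\vee y)$ and $\Delta_{x_n}\cdots\Delta_{x_1}f(x)$ is the iterated difference, obtained by applying the operators $\Delta_{x_1},\ldots,\Delta_{x_n}$ successively to $f$ and evaluating at $x$. $f^\alpha$ denotes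 the pointwise power. *)

theory Defs
  imports Complex_Main
begin

definition covers_of :: "'a::order \<Rightarrow> 'a set" where
  "covers_of x = {y. x < y \<and> \<not> (\<exists>z. x < z \<and> z < y)}"

definition cover_degree :: "'a::order \<Rightarrow> nat" where
  "cover_degree x = card (covers_of x)"

(* A finite lattice is a type of sort {finite, lattice}; the quantity depends on the type only. *)
definition max_cover_degree :: "'a::{finite, lattice} itself \<Rightarrow> nat" where
  "max_cover_degree _ = Max (range (cover_degree :: 'a \<Rightarrow> nat))"

(* Inserting x into the joined set makes the argument of f equal to x for empty J;
   only the values xs 1, ..., xs n matter. *)
definition iterated_difference :: "('a::lattice \<Rightarrow> real) \<Rightarrow> nat \<Rightarrow> (nat \<Rightarrow> 'a) \<Rightarrow> 'a \<Rightarrow> real" where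
  "iterated_difference f n xs x =
     (\<Sum>J\<in>Pow {1..n}. (-1) ^ card J * f (\<Squnion>\<^sub>f\<^sub>i\<^sub>n (insert x (xs ` J))))"

definition completely_monotone :: "('a::lattice \<Rightarrow> real) \<Rightarrow> bool" where
  "completely_monotone f \<longleftrightarrow>
     (\<forall>x. f x \<ge> 0) \<and> (\<forall>n\<ge>1. \<forall>xs x. iterated_difference f n xs x \<ge> 0)"

end

theory Submission
  imports Defs
begin

text \<open>
  Write \<open>\<Delta>\<^sub>y f(x) = f(x) - f(x \<squnion> y)\<close> and call \<open>f\<close> monotone of order \<open>d\<close> when all iterated
  differences with at most \<open>d\<close> operators are nonnegative.  Three observations give the theorem.

  First, the Leibniz rule \<open>\<Delta>\<^sub>y (f g)(x) = \<Delta>\<^sub>y f(x) g(x) + f(x \<squnion> y) \<Delta>\<^sub>y g(x)\<close> makes monotonicity of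
  order \<open>d\<close> stable under products, which settles integer exponents
  (\<open>monotone_of_order_mult\<close>).  For real exponents \<open>\<alpha> \<ge> d - 1\<close> the argument is an induction on
  \<open>d\<close> in the style of FitzGerald and Horn: with \<open>a(x) = f(x \<squnion> y)\<close> and \<open>b = \<Delta>\<^sub>y f\<close>, the function
  \<open>\<Delta>\<^sub>y (f\<^sup>\<alpha>) = (a + b)\<^sup>\<alpha> - a\<^sup>\<alpha>\<close> is the increment over \<open>t \<in> [0, 1]\<close> of \<open>(a + t b)\<^sup>\<alpha>\<close>, whose
  derivative \<open>\<alpha> b (a + t b)\<^bsup>\<alpha> - 1\<^esup>\<close> is a product of two functions that are monotone of order
  \<open>d - 1\<close>, one by hypothesis and one by induction (\<open>monotone_of_order_powr\<close>).

  Second, on a finite lattice it suffices to control the differences along the covers of each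
  point, so monotonicity of order \<open>d\<^sub>m\<^sub>a\<^sub>x\<close> already is complete monotonicity
  (\<open>completely_monotone_if_monotone_of_max_cover_degree\<close>).

  Third, in a distributive lattice the covers of a point \<open>x\<close> of degree \<open>d = d\<^sub>m\<^sub>a\<^sub>x\<close> generate a
  Boolean lattice, on which there is a completely monotone \<open>f\<close> taking the value
  \<open>1 + d - |J|\<close> at the join of a set \<open>J\<close> of covers.  Differences of \<open>f\<^sup>\<alpha>\<close> along \<open>k\<close> covers
  are then \<open>k\<close>-th finite differences of \<open>t \<mapsto> t\<^sup>\<alpha>\<close>, which have the sign of
  \<open>\<alpha> (\<alpha> - 1) \<cdots> (\<alpha> - k + 1)\<close>.  For noninteger \<open>\<alpha> < d - 1\<close> this is negative with
  \<open>k = \<lfloor>\<alpha>\<rfloor> + 2 \<le> d\<close> (\<open>exists_completely_monotone_without_noninteger_powers\<close>).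
\<close>

section \<open>Iterated differences\<close>

unbundle lattice_syntax

definition difference :: "'a::lattice \<Rightarrow> ('a \<Rightarrow> real) \<Rightarrow> 'a \<Rightarrow> real" where
  "difference y f = (\<lambda>x. f x - f (x \<squnion> y))"

abbreviation differences :: "'a::lattice list \<Rightarrow> ('a \<Rightarrow> real) \<Rightarrow> 'a \<Rightarrow> real" where
  "differences ys f \<equiv> foldr difference ys f"

lemma differences_Cons:
  "differences (y # ys) f x = differences ys f x - differences ys f (x \<squnion> y)"
  by (simp add: difference_def)

lemma difference_commute: "difference y (difference z f) = difference z (difference y f)"
  by (simp add: difference_def fun_eq_iff ac_simps)

lemma differences_move_to_front:
  "differences (xs @ y # ys) f = differences (y # xs @ ys) f"
proof (induction xs)
  case (Cons x xs)
  then show ?case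
    by (simp add: difference_commute[of x])
qed simp

lemma differences_add:
  "differences ys (\<lambda>x. f x + g x) x = differences ys f x + differences ys g x"
  by (induction ys arbitrary: x) (simp_all add: difference_def)

lemma differences_cmult: "differences ys (\<lambda>x. c * f x) x = c * differences ys f x"
  by (induction ys arbitrary: x) (simp_all add: difference_def right_diff_distrib)

lemma differences_diff:
  "differences ys (\<lambda>x. f x - g x) x = differences ys f x - differences ys g x"
  by (induction ys arbitrary: x) (simp_all add: difference_def)

lemma differences_shift: "differences ys (\<lambda>x. f (x \<squnion> y)) x = differences ys f (x \<squnion> y)"
  by (induction ys arbitrary: x) (simp_all add: difference_def ac_simps)

lemma differences_eq_0:
  assumes "c \<in> set ys" and "c \<le> x"
  shows "differences ys f x = 0"
  using assms
proof (induction ys arbitrary: x)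
  case (Cons y ys)
  show ?case
  proof (cases "c = y")
    case True
    then have "x \<squnion> y = x"
      using Cons.prems by (simp add: sup_absorb1)
    then show ?thesis
      by (simp add: difference_def)
  next
    case False
    then show ?thesis
      using Cons.prems Cons.IH[of x] Cons.IH[of "x \<squnion> y"] by (simp add: difference_def le_supI1)
  qed
qed simp

lemma continuous_on_differences:
  assumes "\<And>x. continuous_on A (\<lambda>t. F t x)"
  shows "continuous_on A (\<lambda>t. differences ys (F t) x)"
  by (induction ys arbitrary: x) (simp_all add: difference_def assms continuous_on_diff)

lemma has_real_derivative_differences:
  assumes "\<And>x. ((\<lambda>t. F t x) has_real_derivative F' x) (at t)"
  shows "((\<lambda>t. differences ys (F t) x) has_real_derivative differences ys F' x) (at t)"
  by (induction ys arbitrary: x) (simp_all add: difference_def assms DERIV_diff)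

text \<open>
  The subsets of \<open>{1..n + 1}\<close> are split according to whether they contain \<open>n + 1\<close>.  Since this
  peels off the last direction first, \<open>iterated_difference_eq_differences\<close> reverses the list.
\<close>

lemma iterated_difference_Suc:
  "iterated_difference f (Suc n) xs x =
     iterated_difference f n xs x - iterated_difference f n xs (x \<squnion> xs (Suc n))"
proof -
  let ?t = "\<lambda>J. (-1) ^ card J * f (\<Squnion>\<^sub>f\<^sub>i\<^sub>n (insert x (xs ` J)))"
  have Pow: "Pow {1..Suc n} = Pow {1..n} \<union> insert (Suc n) ` Pow {1..n}"
    by (simp add: atLeastAtMostSuc_conv Pow_insert)
  have inj: "inj_on (insert (Suc n)) (Pow {1..n})"
  proof (rule inj_onI)
    fix J K assume "J \<in> Pow {1..n}" "K \<in> Pow {1..n}" "insert (Suc n) J = insert (Suc n) K"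
    moreover have "Suc n \<notin> J" "Suc n \<notin> K"
      using calculation by auto
    ultimately show "J = K"
      by (simp add: insert_ident)
  qed
  have step: "?t (insert (Suc n) J) = - ((-1) ^ card J * f (\<Squnion>\<^sub>f\<^sub>i\<^sub>n (insert (x \<squnion> xs (Suc n)) (xs ` J))))"
    if "J \<in> Pow {1..n}" for J
  proof -
    have fin: "finite J" and "Suc n \<notin> J"
      using that finite_subset by auto
    have "\<Squnion>\<^sub>f\<^sub>i\<^sub>n (insert x (insert (xs (Suc n)) (xs ` J))) = \<Squnion>\<^sub>f\<^sub>i\<^sub>n (insert (x \<squnion> xs (Suc n)) (xs ` J))"
      using fin by (cases "J = {}") (simp_all add: Sup_fin.insert ac_simps)
    then show ?thesis
      using fin \<open>Suc n \<notin> J\<close> by simp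
  qed
  have "iterated_difference f (Suc n) xs x = sum ?t (Pow {1..n}) + sum ?t (insert (Suc n) ` Pow {1..n})"
    unfolding iterated_difference_def Pow by (rule sum.union_disjoint) auto
  also have "sum ?t (insert (Suc n) ` Pow {1..n}) = (\<Sum>J\<in>Pow {1..n}. ?t (insert (Suc n) J))"
    using inj by (simp add: sum.reindex)
  also have "\<dots> = - iterated_difference f n xs (x \<squnion> xs (Suc n))"
    unfolding iterated_difference_def sum_negf[symmetric] by (rule sum.cong[OF refl step])
  finally show ?thesis
    by (simp add: iterated_difference_def)
qed

lemma iterated_difference_eq_differences:
  "iterated_difference f n xs x = differences (map xs (rev [1..<Suc n])) f x"
proof (induction n arbitrary: x)
  case 0
  then show ?case by (simp add: iterated_difference_def)
next
  case (Suc n)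
  have "map xs (rev [1..<Suc (Suc n)]) = xs (Suc n) # map xs (rev [1..<Suc n])"
    by simp
  then show ?case
    by (simp only: iterated_difference_Suc Suc.IH differences_Cons)
qed

lemma list_eq_map_rev_upt: "\<exists>xs. ys = map xs (rev [1..<Suc (length ys)])"
proof (induction ys)
  case (Cons y ys)
  then obtain xs where "ys = map xs (rev [1..<Suc (length ys)])"
    by blast
  moreover have "map (xs(Suc (length ys) := y)) (rev [1..<Suc (length ys)]) =
      map xs (rev [1..<Suc (length ys)])"
    by (rule map_cong) auto
  ultimately have "y # ys = map (xs(Suc (length ys) := y)) (rev [1..<Suc (length (y # ys))])"
    by simp
  then show ?case
    by (intro exI)
qed simp

lemma completely_monotone_iff_differences:
  fixes f :: "'a::lattice \<Rightarrow> real"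
  shows "completely_monotone f \<longleftrightarrow> (\<forall>ys x. differences ys f x \<ge> 0)"
proof
  assume cm: "completely_monotone f"
  show "\<forall>ys x. differences ys f x \<ge> 0"
  proof (intro allI)
    fix ys :: "'a list" and x
    obtain xs where xs: "ys = map xs (rev [1..<Suc (length ys)])"
      using list_eq_map_rev_upt by blast
    show "differences ys f x \<ge> 0"
    proof (cases "ys = []")
      case True
      then show ?thesis
        using cm by (simp add: completely_monotone_def)
    next
      case False
      then have "length ys \<ge> 1"
        by (simp add: Suc_le_eq)
      then have "iterated_difference f (length ys) xs x \<ge> 0"
        using cm by (simp only: completely_monotone_def)
      then show ?thesis
        unfolding iterated_difference_eq_differences xs[symmetric] .
    qed
  qed
next
  assume nonneg: "\<forall>ys x. differences ys f x \<ge> 0"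
  then have "f x \<ge> 0" for x
    using spec[OF nonneg, of "[]"] by simp
  then show "completely_monotone f"
    unfolding completely_monotone_def iterated_difference_eq_differences using nonneg by blast
qed

section \<open>Monotonicity of finite order\<close>

definition monotone_of_order :: "nat \<Rightarrow> ('a::lattice \<Rightarrow> real) \<Rightarrow> bool" where
  "monotone_of_order d f \<longleftrightarrow> (\<forall>ys x. length ys \<le> d \<longrightarrow> differences ys f x \<ge> 0)"

lemma completely_monotone_iff_monotone_of_order:
  "completely_monotone f \<longleftrightarrow> (\<forall>d. monotone_of_order d f)"
  unfolding completely_monotone_iff_differences monotone_of_order_def by blast

lemma monotone_of_order_nonneg:
  assumes "monotone_of_order d f"
  shows "f x \<ge> 0"
  using assms[unfolded monotone_of_order_def, rule_format, of "[]" x] by simp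

lemma monotone_of_order_0: "monotone_of_order 0 f \<longleftrightarrow> (\<forall>x. f x \<ge> 0)"
  by (simp add: monotone_of_order_def)

lemma monotone_of_order_SucD: "monotone_of_order (Suc d) f \<Longrightarrow> monotone_of_order d f"
  by (simp add: monotone_of_order_def)

lemma monotone_of_order_Suc:
  fixes f :: "'a::lattice \<Rightarrow> real"
  shows "monotone_of_order (Suc d) f \<longleftrightarrow> (\<forall>x. f x \<ge> 0) \<and> (\<forall>y. monotone_of_order d (difference y f))"
proof
  assume f: "monotone_of_order (Suc d) f"
  have "differences ys (difference y f) x \<ge> 0" if "length ys \<le> d" for ys y x
    using f[unfolded monotone_of_order_def, rule_format, of "ys @ [y]" x] that by simp
  then show "(\<forall>x. f x \<ge> 0) \<and> (\<forall>y. monotone_of_order d (difference y f))"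
    using monotone_of_order_nonneg[OF f] by (simp add: monotone_of_order_def)
next
  assume f: "(\<forall>x. f x \<ge> 0) \<and> (\<forall>y. monotone_of_order d (difference y f))"
  show "monotone_of_order (Suc d) f"
    unfolding monotone_of_order_def
  proof (intro allI impI)
    fix ys :: "'a list" and x
    assume "length ys \<le> Suc d"
    then show "differences ys f x \<ge> 0"
      using f by (cases ys rule: rev_cases) (simp_all add: monotone_of_order_def)
  qed
qed

lemma monotone_of_order_add:
  assumes "monotone_of_order d f" and "monotone_of_order d g"
  shows "monotone_of_order d (\<lambda>x. f x + g x)"
  using assms by (simp add: monotone_of_order_def differences_add)

lemma monotone_of_order_cmult:
  assumes "monotone_of_order d f" and "c \<ge> 0"
  shows "monotone_of_order d (\<lambda>x. c * f x)"
  using assms by (simp add: monotone_of_order_def differences_cmult)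

lemma monotone_of_order_shift:
  assumes "monotone_of_order d f"
  shows "monotone_of_order d (\<lambda>x. f (x \<squnion> y))"
  using assms by (simp add: monotone_of_order_def differences_shift)

lemma monotone_of_order_const:
  assumes "c \<ge> 0"
  shows "monotone_of_order d (\<lambda>_. c)"
  using assms
proof (induction d arbitrary: c)
  case (Suc d)
  then show ?case
    by (simp add: monotone_of_order_Suc difference_def)
qed (simp add: monotone_of_order_0)

lemma monotone_of_order_sum:
  assumes "\<And>i. i \<in> I \<Longrightarrow> monotone_of_order d (f i)"
  shows "monotone_of_order d (\<lambda>x. \<Sum>i\<in>I. f i x)"
  using assms
  by (induction I rule: infinite_finite_induct)
    (simp_all add: monotone_of_order_add monotone_of_order_const)

text \<open>
  The indicator of a principal down-set: \<open>\<Delta>\<^sub>y\<close> either kills it or leaves it unchanged, since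
  \<open>x \<squnion> y \<le> z\<close> splits into \<open>x \<le> z\<close> and \<open>y \<le> z\<close>.
\<close>

lemma monotone_of_order_indicator:
  "monotone_of_order d (\<lambda>x. of_bool (x \<le> z))"
proof (induction d)
  case (Suc d)
  have "difference y (\<lambda>x. of_bool (x \<le> z)) = (if y \<le> z then (\<lambda>_. 0) else (\<lambda>x. of_bool (x \<le> z)))" for y
    by (auto simp: difference_def fun_eq_iff)
  then show ?case
    using Suc.IH by (simp add: monotone_of_order_Suc monotone_of_order_const)
qed (simp add: monotone_of_order_0)

section \<open>Products and powers\<close>

text \<open>
  Induction on the order through the Leibniz rule for \<open>\<Delta>\<^sub>y\<close>; both summands are products of
  functions of the next lower order.
\<close>

lemma monotone_of_order_mult:
  assumes "monotone_of_order d f" and "monotone_of_order d g"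
  shows "monotone_of_order d (\<lambda>x. f x * g x)"
  using assms
proof (induction d arbitrary: f g)
  case 0
  then show ?case by (simp add: monotone_of_order_0)
next
  case (Suc d)
  have "monotone_of_order d (difference y (\<lambda>x. f x * g x))" for y
  proof -
    have leibniz: "difference y (\<lambda>x. f x * g x) =
        (\<lambda>x. difference y f x * g x + f (x \<squnion> y) * difference y g x)"
      by (simp add: difference_def fun_eq_iff algebra_simps)
    show ?thesis
      unfolding leibniz using Suc.prems
      by (intro monotone_of_order_add Suc.IH monotone_of_order_shift)
        (auto simp: monotone_of_order_Suc intro: monotone_of_order_SucD[OF Suc.prems(1)]
          monotone_of_order_SucD[OF Suc.prems(2)])
  qed
  then show ?case
    using Suc.prems by (simp add: monotone_of_order_Suc)
qed

lemma monotone_of_order_power: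
  "monotone_of_order d f \<Longrightarrow> monotone_of_order d (\<lambda>x. f x ^ n)"
  by (induction n) (simp_all add: monotone_of_order_const monotone_of_order_mult)

text \<open>
  The derivative of \<open>t \<mapsto> (a + t b)\<^sup>\<alpha>\<close> is needed only for \<open>t > 0\<close>, where the base vanishes
  only if \<open>b = 0\<close> and the function is constant.
\<close>

lemma has_real_derivative_powr_affine:
  fixes a b t \<alpha> :: real
  assumes "a \<ge> 0" and "b \<ge> 0" and "t > 0"
  shows "((\<lambda>t. (a + t * b) powr \<alpha>) has_real_derivative \<alpha> * (b * (a + t * b) powr (\<alpha> - 1))) (at t)"
proof (cases "b = 0")
  case False
  then have "a + t * b > 0"
    using assms by (simp add: add_nonneg_pos)
  then show ?thesis
    by (auto intro!: derivative_eq_intros)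
qed simp

text \<open>
  The induction step raises the order and the exponent by one at the same time, which is why the
  threshold is \<open>d - 1\<close>.  It starts at order one, where any positive exponent works because
  powers are increasing.
\<close>

lemma monotone_of_order_powr:
  fixes f :: "'a::lattice \<Rightarrow> real"
  assumes "monotone_of_order d f" and "\<alpha> > 0" and "\<alpha> \<ge> real d - 1"
  shows "monotone_of_order d (\<lambda>x. f x powr \<alpha>)"
  using assms
proof (induction d arbitrary: f \<alpha>)
  case 0
  then show ?case by (simp add: monotone_of_order_0)
next
  case (Suc d)
  have f_nonneg: "f x \<ge> 0" for x
    using monotone_of_order_nonneg[OF Suc.prems(1)] .
  have b: "monotone_of_order d (difference y f)" for y
    using Suc.prems(1) by (simp add: monotone_of_order_Suc)
  have antimono: "f (x \<squnion> y) \<le> f x" for x y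
    using monotone_of_order_nonneg[OF b, of y x] by (simp add: difference_def)
  consider "d = 0" | "\<alpha> = 1" | "d \<ge> 1" "\<alpha> > 1"
    using Suc.prems(3) by (cases "d = 0"; cases "\<alpha> = 1") auto
  then show ?case
  proof cases
    case 1
    then show ?thesis
      using antimono f_nonneg Suc.prems(2)
      by (simp add: monotone_of_order_Suc monotone_of_order_0 difference_def powr_mono2)
  next
    case 2
    then show ?thesis
      using Suc.prems(1) f_nonneg by simp
  next
    case 3
    have "monotone_of_order d (difference y (\<lambda>x. f x powr \<alpha>))" for y
      unfolding monotone_of_order_def
    proof (intro allI impI)
      fix ys :: "'a list" and x
      assume len: "length ys \<le> d"
      define a where "a = (\<lambda>x. f (x \<squnion> y))"
      define b where "b = difference y f"
      have a_mono: "monotone_of_order d a"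
        unfolding a_def
        by (rule monotone_of_order_shift[OF monotone_of_order_SucD[OF Suc.prems(1)]])
      have b_mono: "monotone_of_order d b"
        unfolding b_def by fact
      have a_nonneg: "a x \<ge> 0" and b_nonneg: "b x \<ge> 0" for x
        using monotone_of_order_nonneg a_mono b_mono by auto
      let ?F = "\<lambda>t x. (a x + t * b x) powr \<alpha>"
      have "differences ys (?F 0) x \<le> differences ys (?F 1) x"
      proof (rule DERIV_nonneg_imp_increasing_open[where f = "\<lambda>t. differences ys (?F t) x"])
        fix t :: real
        assume t: "0 < t" "t < 1"
        let ?F' = "\<lambda>x. \<alpha> * (b x * (a x + t * b x) powr (\<alpha> - 1))"
        have "((\<lambda>t. differences ys (?F t) x) has_real_derivative differences ys ?F' x) (at t)"
          using t a_nonneg b_nonneg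
          by (intro has_real_derivative_differences has_real_derivative_powr_affine) auto
        moreover have "monotone_of_order d ?F'"
          using t 3 Suc.prems a_mono b_mono
          by (intro monotone_of_order_cmult monotone_of_order_mult Suc.IH monotone_of_order_add) auto
        then have "differences ys ?F' x \<ge> 0"
          using len by (simp add: monotone_of_order_def)
        ultimately show "\<exists>D. ((\<lambda>t. differences ys (?F t) x) has_real_derivative D) (at t) \<and> D \<ge> 0"
          by blast
      next
        show "continuous_on {0..1} (\<lambda>t. differences ys (?F t) x)"
          using a_nonneg b_nonneg 3
          by (intro continuous_on_differences continuous_on_powr' continuous_intros) auto
      qed simp
      moreover have "difference y (\<lambda>x. f x powr \<alpha>) = (\<lambda>x. ?F 1 x - ?F 0 x)"
        by (simp add: difference_def a_def b_def fun_eq_iff)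
      ultimately show "differences ys (difference y (\<lambda>x. f x powr \<alpha>)) x \<ge> 0"
        by (simp add: differences_diff)
    qed
    then show ?thesis
      by (simp add: monotone_of_order_Suc)
  qed
qed

section \<open>Covers control all differences\<close>

lemma exists_cover_below:
  fixes x w :: "'a::{finite, order}"
  assumes "x < w"
  shows "\<exists>c\<in>covers_of x. c \<le> w"
proof -
  obtain c where c: "c \<in> {z. x < z \<and> z \<le> w}" and
    minimal: "\<forall>z\<in>{z. x < z \<and> z \<le> w}. z \<le> c \<longrightarrow> c = z"
    using finite_has_minimal[of "{z. x < z \<and> z \<le> w}"] assms by auto
  then have "c \<in> covers_of x"
    unfolding covers_of_def by (auto dest: less_imp_le order.strict_trans2)
  then show ?thesis
    using c by blast
qed

lemma cover_degree_le_max_cover_degree: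
  "cover_degree (x :: 'a::{finite, lattice}) \<le> max_cover_degree TYPE('a)"
  by (simp add: max_cover_degree_def)

lemma exists_cover_degree_eq_max:
  "\<exists>x :: 'a::{finite, lattice}. cover_degree x = max_cover_degree TYPE('a)"
proof -
  have "max_cover_degree TYPE('a) \<in> range (cover_degree :: 'a \<Rightarrow> nat)"
    unfolding max_cover_degree_def by (rule Max_in) auto
  then show ?thesis
    by (auto simp: eq_commute)
qed

text \<open>
  Once the covers of \<open>x\<close> are among the difference directions, a further direction \<open>y \<not>\<le> x\<close>
  changes nothing: the correction term lives at \<open>x \<squnion> y\<close>, which lies above one of the covers.
\<close>

lemma differences_append_covers:
  fixes g :: "'a::{finite, lattice} \<Rightarrow> real"
  assumes "set cs = covers_of x" and "\<forall>y\<in>set ys. \<not> y \<le> x"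
  shows "differences (cs @ ys) g x = differences cs g x"
  using assms(2)
proof (induction ys)
  case (Cons y ys)
  have "x < x \<squnion> y"
    using Cons.prems by (simp add: less_le_not_le)
  then obtain c where "c \<in> set cs" "c \<le> x \<squnion> y"
    using exists_cover_below assms(1) by metis
  then have "differences (cs @ ys) g (x \<squnion> y) = 0"
    by (intro differences_eq_0[of c]) auto
  then show ?case
    using Cons by (simp only: differences_move_to_front differences_Cons) simp
qed simp

text \<open>
  Downward induction over the lattice.  Adding the covers of \<open>x\<close> to the directions \<open>ys\<close>
  subtracts differences taken at points strictly above \<open>x\<close>, which are nonnegative by
  induction, so it can only decrease the value; and it reduces the case to the covers alone.
\<close>

lemma completely_monotone_if_monotone_of_max_cover_degree:
  fixes g :: "'a::{finite, lattice} \<Rightarrow> real"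
  assumes "monotone_of_order (max_cover_degree TYPE('a)) g"
  shows "completely_monotone g"
proof -
  have "differences ys g x \<ge> 0" for ys x
  proof (induction "card {z. x < z}" arbitrary: x ys rule: less_induct)
    case less
    have above: "differences ys g z \<ge> 0" if "x < z" for z ys
    proof (rule less)
      have "{w. z < w} \<subset> {w. x < w}"
        using that by (auto intro: order.strict_trans)
      then show "card {w. z < w} < card {w. x < w}"
        by (simp add: psubset_card_mono)
    qed
    show ?case
    proof (cases "\<exists>y\<in>set ys. y \<le> x")
      case True
      then show ?thesis
        using differences_eq_0 by fastforce
    next
      case False
      obtain cs where cs: "set cs = covers_of x" "distinct cs"
        using finite_distinct_list[of "covers_of x"] by auto
      have "differences (zs @ ys) g x \<le> differences ys g x" if "set zs \<subseteq> covers_of x" for zs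
        using that
      proof (induction zs)
        case (Cons z zs)
        then have "x < x \<squnion> z"
          by (auto simp: covers_of_def less_supI2)
        then have "differences (zs @ ys) g (x \<squnion> z) \<ge> 0"
          by (rule above)
        then show ?case
          using Cons by (simp only: append_Cons differences_Cons) simp
      qed simp
      then have "differences (cs @ ys) g x \<le> differences ys g x"
        using cs by simp
      moreover have "differences (cs @ ys) g x = differences cs g x"
        using cs False by (intro differences_append_covers) auto
      moreover have "length cs \<le> max_cover_degree TYPE('a)"
        using cs cover_degree_le_max_cover_degree[of x] distinct_card[of cs]
        by (simp add: cover_degree_def)
      then have "differences cs g x \<ge> 0"
        using assms by (simp add: monotone_of_order_def)
      ultimately show ?thesis
        by simp
    qed
  qed
  then show ?thesis
    by (simp add: completely_monotone_iff_differences)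
qed

lemma completely_monotone_powr:
  fixes f :: "'a::{finite, lattice} \<Rightarrow> real"
  assumes f: "completely_monotone f" and \<alpha>: "\<alpha> > 0"
    and exponent: "\<alpha> \<in> \<int> \<or> \<alpha> \<ge> real (max_cover_degree TYPE('a)) - 1"
  shows "completely_monotone (\<lambda>x. f x powr \<alpha>)"
  using exponent
proof
  assume "\<alpha> \<in> \<int>"
  then obtain n where n: "\<alpha> = real n"
    using \<alpha> by (metis Ints_cases of_int_0_less_iff of_int_of_nat_eq pos_int_cases)
  have "f x powr \<alpha> = f x ^ n" for x
    using f \<alpha> n by (simp add: completely_monotone_def powr_realpow')
  then show ?thesis
    using f by (simp add: completely_monotone_iff_monotone_of_order monotone_of_order_power)
next
  assume "\<alpha> \<ge> real (max_cover_degree TYPE('a)) - 1"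
  then show ?thesis
    using f \<alpha> by (intro completely_monotone_if_monotone_of_max_cover_degree monotone_of_order_powr)
      (simp_all add: completely_monotone_iff_monotone_of_order)
qed

section \<open>Finite differences of real powers\<close>

fun backward_difference :: "nat \<Rightarrow> (real \<Rightarrow> real) \<Rightarrow> real \<Rightarrow> real" where
  "backward_difference 0 h t = h t"
| "backward_difference (Suc k) h t = backward_difference k h t - backward_difference k h (t - 1)"

lemma backward_difference_cmult:
  "backward_difference k (\<lambda>t. c * h t) t = c * backward_difference k h t"
  by (induction k arbitrary: t) (simp_all add: right_diff_distrib)

lemma has_real_derivative_backward_difference:
  assumes "\<And>s. s > 0 \<Longrightarrow> (h has_real_derivative h' s) (at s)" and "t > real k"
  shows "(backward_difference k h has_real_derivative backward_difference k h' t) (at t)"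
  using assms(2)
proof (induction k arbitrary: t)
  case 0
  then show ?case
    using assms(1) by simp
next
  case (Suc k)
  have "(backward_difference k h has_real_derivative backward_difference k h' t) (at t)"
    using Suc by simp
  moreover have "((\<lambda>t. backward_difference k h (t - 1)) has_real_derivative
      backward_difference k h' (t - 1)) (at t)"
    using Suc.IH[of "t - 1"] Suc.prems DERIV_shift[of "backward_difference k h" _ t "-1"] by simp
  ultimately have "((\<lambda>t. backward_difference k h t - backward_difference k h (t - 1))
      has_real_derivative backward_difference k h' t - backward_difference k h' (t - 1)) (at t)"
    by (rule DERIV_diff)
  then show ?case
    by simp
qed

text \<open>
  By the mean value theorem each backward difference trades \<open>t\<^sup>\<alpha>\<close> for \<open>\<alpha> s\<^bsup>\<alpha> - 1\<^esup>\<close> at some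
  \<open>s > t - 1\<close>, so \<open>k\<close> of them produce the falling factorial of \<open>\<alpha>\<close> times a positive number.
\<close>

lemma backward_difference_powr:
  assumes "t > real k"
  shows "\<exists>r>0. backward_difference k (\<lambda>s. s powr \<alpha>) t = r * (\<Prod>i<k. \<alpha> - real i)"
  using assms
proof (induction k arbitrary: t \<alpha>)
  case 0
  then show ?case
    by (intro exI[of _ "t powr \<alpha>"]) simp
next
  case (Suc k)
  let ?B = "backward_difference k (\<lambda>s. s powr \<alpha>)"
  let ?B' = "\<lambda>s. \<alpha> * backward_difference k (\<lambda>s. s powr (\<alpha> - 1)) s"
  have deriv: "(?B has_real_derivative ?B' s) (at s)" if "s > real k" for s
    using that unfolding backward_difference_cmult[symmetric]
    by (intro has_real_derivative_backward_difference) (auto intro!: derivative_eq_intros)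
  obtain s where s: "s > t - 1" "?B t - ?B (t - 1) = (t - (t - 1)) * ?B' s"
    using MVT2[of "t - 1" t ?B ?B'] deriv Suc.prems by fastforce
  obtain r where r: "r > 0"
    "backward_difference k (\<lambda>s. s powr (\<alpha> - 1)) s = r * (\<Prod>i<k. (\<alpha> - 1) - real i)"
    using Suc.IH[of s "\<alpha> - 1"] s(1) Suc.prems by auto
  have "(\<Prod>i<Suc k. \<alpha> - real i) = \<alpha> * (\<Prod>i<k. (\<alpha> - 1) - real i)"
    by (simp only: prod.lessThan_Suc_shift) (simp add: algebra_simps)
  then have "backward_difference (Suc k) (\<lambda>s. s powr \<alpha>) t = r * (\<Prod>i<Suc k. \<alpha> - real i)"
    using s(2) r(2) by simp
  then show ?case
    using r(1) by blast
qed

lemma falling_factorial_neg: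
  fixes \<alpha> :: real
  assumes "real m < \<alpha>" and "\<alpha> < real (Suc m)"
  shows "(\<Prod>i<Suc (Suc m). \<alpha> - real i) < 0"
proof -
  have "(\<Prod>i<Suc m. \<alpha> - real i) > 0"
    using assms(1) by (intro prod_pos) auto
  moreover have "\<alpha> - real (Suc m) < 0"
    using assms(2) by simp
  ultimately show ?thesis
    by (subst prod.lessThan_Suc) (rule mult_pos_neg)
qed

section \<open>Distributive lattices\<close>

lemma inf_Sup_fin_le:
  fixes c x :: "'a::distrib_lattice"
  assumes "finite A" and "A \<noteq> {}" and "\<And>a. a \<in> A \<Longrightarrow> c \<sqinter> a \<le> x"
  shows "c \<sqinter> \<Squnion>\<^sub>f\<^sub>i\<^sub>n A \<le> x"
  using assms by (induction A rule: finite_ne_induct) (simp_all add: inf_sup_distrib1)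

text \<open>
  Two distinct covers of \<open>x\<close> meet in \<open>x\<close>; by distributivity the same holds for a cover and a
  join of other covers.  The element \<open>x\<close> is inserted to make the join meaningful when \<open>x\<close> has a
  single cover.
\<close>

lemma cover_not_le_join_of_other_covers:
  fixes x :: "'a::{finite, distrib_lattice}"
  assumes "c \<in> covers_of x"
  shows "\<not> c \<le> \<Squnion>\<^sub>f\<^sub>i\<^sub>n (insert x (covers_of x - {c}))"
proof
  assume le: "c \<le> \<Squnion>\<^sub>f\<^sub>i\<^sub>n (insert x (covers_of x - {c}))"
  have "c \<sqinter> e \<le> x" if e: "e \<in> covers_of x - {c}" for e
  proof -
    have "x \<le> c \<sqinter> e" and "c \<sqinter> e \<le> c" "c \<sqinter> e \<le> e"
      using assms e by (auto simp: covers_of_def less_imp_le)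
    moreover have "c \<sqinter> e \<noteq> c"
    proof
      assume "c \<sqinter> e = c"
      then have "c < e"
        using e by (auto simp: less_le inf.absorb_iff1)
      then show False
        using assms e by (auto simp: covers_of_def)
    qed
    ultimately have "c \<sqinter> e < c"
      by (simp add: less_le)
    then have "\<not> x < c \<sqinter> e"
      using assms by (auto simp: covers_of_def)
    then show ?thesis
      using \<open>x \<le> c \<sqinter> e\<close> by (simp add: less_le)
  qed
  then have "c \<sqinter> \<Squnion>\<^sub>f\<^sub>i\<^sub>n (insert x (covers_of x - {c})) \<le> x"
    by (intro inf_Sup_fin_le) auto
  then have "c \<le> x"
    using le by (simp add: inf.absorb1)
  then show False
    using assms by (auto simp: covers_of_def)
qed

text \<open>
  Joining one of the counted \<open>c\<close> to \<open>x\<close> removes exactly that \<open>c\<close> from the set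
  \<open>{c \<in> C. x \<le> z c}\<close>, so its cardinality drops by one and the other directions stay counted;
  functions of this number thus turn lattice differences into backward differences.
\<close>

lemma differences_eq_backward_difference:
  fixes z :: "'a::lattice \<Rightarrow> 'a"
  assumes "finite C" and z: "\<And>c e. c \<in> C \<Longrightarrow> e \<in> C \<Longrightarrow> e \<le> z c \<longleftrightarrow> e \<noteq> c"
    and "distinct cs" and "set cs \<subseteq> {c \<in> C. x \<le> z c}"
  shows "differences cs (\<lambda>x. h (1 + real (card {c \<in> C. x \<le> z c}))) x =
    backward_difference (length cs) h (1 + real (card {c \<in> C. x \<le> z c}))"
  using assms(3,4)
proof (induction cs arbitrary: x)
  case (Cons e cs)
  have e: "e \<in> {c \<in> C. x \<le> z c}"
    using Cons.prems by simp
  then have S: "{c \<in> C. x \<squnion> e \<le> z c} = {c \<in> C. x \<le> z c} - {e}"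
    using z by auto
  then have "card {c \<in> C. x \<le> z c} = Suc (card {c \<in> C. x \<squnion> e \<le> z c})"
    using card.remove[OF _ e] assms(1) by simp
  moreover have "set cs \<subseteq> {c \<in> C. x \<squnion> e \<le> z c}"
    unfolding S using Cons.prems by auto
  ultimately show ?case
    using Cons by (simp add: difference_def)
qed simp

text \<open>
  The witness is the function whose Moebius inverse puts mass one on the top element and on each
  join of all covers but one, at a point with the largest number of covers.
\<close>

lemma exists_completely_monotone_without_noninteger_powers:
  "\<exists>f :: 'b::{finite, distrib_lattice} \<Rightarrow> real.
     completely_monotone f \<and>
     (\<forall>\<alpha>::real. \<alpha> > 0 \<and> \<alpha> \<notin> \<int> \<and> \<alpha> < real (max_cover_degree TYPE('b)) - 1 \<longrightarrow>
        \<not> completely_monotone (\<lambda>x. f x powr \<alpha>))"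
proof -
  obtain x :: 'b where x: "cover_degree x = max_cover_degree TYPE('b)"
    using exists_cover_degree_eq_max by blast
  define C where "C = covers_of x"
  define z where "z = (\<lambda>c. \<Squnion>\<^sub>f\<^sub>i\<^sub>n (insert x (C - {c})))"
  define f where "f = (\<lambda>y. 1 + real (card {c \<in> C. y \<le> z c}))"
  have z: "e \<le> z c \<longleftrightarrow> e \<noteq> c" if "c \<in> C" "e \<in> C" for c e
  proof
    assume "e \<noteq> c"
    then show "e \<le> z c"
      unfolding z_def using that by (intro Sup_fin.coboundedI) auto
  qed (use that cover_not_le_join_of_other_covers[of c x] in \<open>auto simp: z_def C_def\<close>)
  have "x \<le> z c" for c
    unfolding z_def by (intro Sup_fin.coboundedI) auto
  then have below: "{c \<in> C. x \<le> z c} = C"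
    by auto
  have "f = (\<lambda>y. 1 + (\<Sum>c\<in>C. of_bool (y \<le> z c)))"
    by (simp add: f_def fun_eq_iff Int_def)
  moreover have "monotone_of_order d (\<lambda>y. 1 + (\<Sum>c\<in>C. of_bool (y \<le> z c)))" for d
    by (intro monotone_of_order_add monotone_of_order_const monotone_of_order_sum
        monotone_of_order_indicator) simp
  ultimately have "completely_monotone f"
    by (simp add: completely_monotone_iff_monotone_of_order)
  moreover have "\<not> completely_monotone (\<lambda>y. f y powr \<alpha>)"
    if \<alpha>: "\<alpha> > 0" "\<alpha> \<notin> \<int>" "\<alpha> < real (max_cover_degree TYPE('b)) - 1" for \<alpha>
  proof -
    \<comment> \<open>With \<open>k = m + 2\<close> directions the last factor \<open>\<alpha> - (m + 1)\<close> is the only negative one.\<close>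
    define m where "m = nat \<lfloor>\<alpha>\<rfloor>"
    have m: "real m < \<alpha>" "\<alpha> < real (Suc m)"
    proof -
      have "real m = of_int \<lfloor>\<alpha>\<rfloor>"
        using \<alpha>(1) by (simp add: m_def)
      moreover have "of_int \<lfloor>\<alpha>\<rfloor> \<noteq> \<alpha>"
        using \<alpha>(2) by (metis Ints_of_int)
      ultimately show "real m < \<alpha>" "\<alpha> < real (Suc m)"
        using of_int_floor_le[of \<alpha>] floor_correct[of \<alpha>] by linarith+
    qed
    have card: "card C = max_cover_degree TYPE('b)"
      using x by (simp add: C_def cover_degree_def)
    then have "Suc (Suc m) \<le> card C"
      using m(1) \<alpha>(3) by linarith
    then obtain D where D: "D \<subseteq> C" "card D = Suc (Suc m)"
      by (metis obtain_subset_with_card_n)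
    obtain cs where cs: "set cs = D" "distinct cs"
      using finite_distinct_list[of D] by auto
    have len: "length cs = Suc (Suc m)"
      using cs D distinct_card by metis
    have "differences cs (\<lambda>y. f y powr \<alpha>) x =
        backward_difference (Suc (Suc m)) (\<lambda>s. s powr \<alpha>) (1 + real (card C))"
      using differences_eq_backward_difference[of C z cs x "\<lambda>s. s powr \<alpha>"] z cs D(1)
      unfolding f_def below len by simp
    moreover obtain r where "r > 0"
      "backward_difference (Suc (Suc m)) (\<lambda>s. s powr \<alpha>) (1 + real (card C)) =
        r * (\<Prod>i<Suc (Suc m). \<alpha> - real i)"
      using backward_difference_powr[of "Suc (Suc m)" "1 + real (card C)" \<alpha>]
        \<open>Suc (Suc m) \<le> card C\<close> by auto
    ultimately have "differences cs (\<lambda>y. f y powr \<alpha>) x < 0"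
      using falling_factorial_neg[OF m] by (simp only: mult_pos_neg)
    then show ?thesis
      unfolding completely_monotone_iff_differences by (meson not_le)
  qed
  ultimately show ?thesis
    by blast
qed

section \<open>The critical exponents\<close>

theorem theorem6:
  shows "(\<forall>(f :: 'a::{finite, lattice} \<Rightarrow> real) (\<alpha>::real).
            \<alpha> > 0 \<longrightarrow> completely_monotone f \<longrightarrow>
            \<alpha> \<in> \<int> \<or> \<alpha> \<ge> real (max_cover_degree TYPE('a)) - 1 \<longrightarrow>
            completely_monotone (\<lambda>x. f x powr \<alpha>))
       \<and> (\<exists>f :: 'b::{finite, distrib_lattice} \<Rightarrow> real.
            completely_monotone f \<and>
            (\<forall>\<alpha>::real. \<alpha> > 0 \<and> \<alpha> \<notin> \<int> \<and> \<alpha> < real (max_cover_degree TYPE('b)) - 1 \<longrightarrow>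
               \<not> completely_monotone (\<lambda>x. f x powr \<alpha>)))
       \<and> {\<alpha>::real. \<alpha> > 0 \<and> (\<forall>f :: 'b \<Rightarrow> real. completely_monotone f \<longrightarrow>
                                 completely_monotone (\<lambda>x. f x powr \<alpha>))}
         = {\<alpha>. \<alpha> > 0 \<and> \<alpha> \<in> \<nat> \<union> {real (max_cover_degree TYPE('b)) - 1..}}"
proof (intro conjI)
  show "\<forall>(f :: 'a \<Rightarrow> real) (\<alpha>::real).
            \<alpha> > 0 \<longrightarrow> completely_monotone f \<longrightarrow>
            \<alpha> \<in> \<int> \<or> \<alpha> \<ge> real (max_cover_degree TYPE('a)) - 1 \<longrightarrow>
            completely_monotone (\<lambda>x. f x powr \<alpha>)"
    by (intro allI impI completely_monotone_powr)
next
  show witness: "\<exists>f :: 'b \<Rightarrow> real.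
            completely_monotone f \<and>
            (\<forall>\<alpha>::real. \<alpha> > 0 \<and> \<alpha> \<notin> \<int> \<and> \<alpha> < real (max_cover_degree TYPE('b)) - 1 \<longrightarrow>
               \<not> completely_monotone (\<lambda>x. f x powr \<alpha>))"
    by (rule exists_completely_monotone_without_noninteger_powers)
  have "\<alpha> \<in> \<nat> \<longleftrightarrow> \<alpha> \<in> \<int>" if "\<alpha> > 0" for \<alpha> :: real
    using that by (simp add: Nats_altdef2)
  then show "{\<alpha>::real. \<alpha> > 0 \<and> (\<forall>f :: 'b \<Rightarrow> real. completely_monotone f \<longrightarrow>
                                 completely_monotone (\<lambda>x. f x powr \<alpha>))}
         = {\<alpha>. \<alpha> > 0 \<and> \<alpha> \<in> \<nat> \<union> {real (max_cover_degree TYPE('b)) - 1..}}"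
    using witness completely_monotone_powr[where 'a = 'b]
    by (auto simp: not_le)
qed

end
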